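(* Let $(X,\tau)$ be a noncompact metrizable space, let $F\subseteq X$ be finite with $|F|\ge2$, and let $a,b$ be any two distinct points of $F$. There exist coarsenings $\sigma_a,\sigma_b\in\mathcal L_F^m(\tau)$, both strict (i.e. $\sigma_a\subsetneq\tau$ and $\sigma_b\subsetneq\tau$), and a countably infinite $\tau$-closed discrete set $D=\{x_n:n\in\mathbb N\}\subseteq X\setminus F$ such that $$\sigma_a|_{X\setminus\{a\}}=\tau|_{X\setminus\{a\}},\qquad \sigma_b|_{X\setminus\{b\}}=\tau|_{X\setminus\{b\}},$$ and $$x_n\longrightarrow a\text{ in }\sigma_a,\qquad x_n\longrightarrow b\text{ in }\sigma_b.$$ In particular, every topology on $X$ coarser than both $\sigma_a$ and $\sigma_b$ is non-Hausdorff.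
   Context: $\mathcal L_F^m(\tau)$ is the family of all metrizable topologies $\sigma$ on $X$ with $\sigma\subseteq\tau$ and $\sigma|_{X\setminus F}=\tau|_{X\setminus F}$ (equal subspace topologies on $X\setminus F$), ordered by inclusion. "Coarser" is not necessarily strict. *)

theory Defs
  imports "HOL-Analysis.Analysis"
begin

text \<open>
  A topology on a set \<open>X\<close> is a value of type \<open>'a topology\<close> whose \<open>topspace\<close> is \<open>X\<close>; the underlying
  set is part of the comparison, and coarser is not necessarily strict.
\<close>

definition coarser :: "'a topology \<Rightarrow> 'a topology \<Rightarrow> bool" where
  "coarser \<sigma> \<tau> \<longleftrightarrow>
     topspace \<sigma> = topspace \<tau> \<and> (\<forall>U. openin \<sigma> U \<longrightarrow> openin \<tau> U)"

definition strictly_coarser :: "'a topology \<Rightarrow> 'a topology \<Rightarrow> bool" where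
  "strictly_coarser \<sigma> \<tau> \<longleftrightarrow> coarser \<sigma> \<tau> \<and> \<sigma> \<noteq> \<tau>"

text \<open>The family $\mathcal{L}_F^m(\tau)$.\<close>

definition metrizable_coarsenings :: "'a set \<Rightarrow> 'a topology \<Rightarrow> 'a topology set" where
  "metrizable_coarsenings F \<tau> =
     {\<sigma>. metrizable_space \<sigma> \<and> coarser \<sigma> \<tau> \<and>
         subtopology \<sigma> (topspace \<tau> - F) = subtopology \<tau> (topspace \<tau> - F)}"

end

theory Submission
  imports Defs
begin

text \<open>
  A noncompact metric space contains an infinite set without accumulation points; removing the finite
  set \<open>F\<close> and passing to a countable subset gives an injective sequence \<open>x\<close> whose range \<open>D\<close> is closed and
  discrete. For each point \<open>p\<close> outside \<open>D\<close> the metric \<open>d\<close> is then shortened so that \<open>x\<close> converges to \<open>p\<close>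
  and nothing else changes.

  The shortening uses a height \<open>h\<close>, nonnegative and 1-Lipschitz, that vanishes exactly at \<open>p\<close>. The
  formula \<open>min (d u v) (h u + h v)\<close> lets one travel from \<open>u\<close> to \<open>v\<close> either directly or through \<open>p\<close>, at
  the cost of the two heights; the Lipschitz condition is what the triangle inequality needs. Balls
  around \<open>u \<noteq> p\<close> of radius at most \<open>h u\<close> are unchanged, because the detour is too expensive there, so the
  topology changes only at \<open>p\<close>; and a sequence converges to \<open>p\<close> as soon as its heights tend to 0. The
  height used here is the least cost of reaching \<open>p\<close> when, besides the direct way, there is a
  tunnel of length \<open>1 / (n + 1)\<close> from each \<open>x n\<close> to \<open>p\<close>. It is positive away from \<open>p\<close> because only finitely
  many \<open>x n\<close> lie near any given point.

  Applied to \<open>a\<close> and to \<open>b\<close> this gives two topologies in which the same sequence \<open>x\<close> converges to \<open>a\<close> and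
  to \<open>b\<close> respectively. A topology coarser than both has two limits for \<open>x\<close> and is not Hausdorff.
\<close>

section \<open>Shortening a metric through one point\<close>

definition detour_metric :: "('a \<Rightarrow> 'a \<Rightarrow> real) \<Rightarrow> ('a \<Rightarrow> real) \<Rightarrow> 'a \<Rightarrow> 'a \<Rightarrow> real" where
  "detour_metric d h u v = min (d u v) (h u + h v)"

context Metric_space
begin

lemma Metric_space_detour_metric:
  assumes nonneg_h: "\<And>u. 0 \<le> h u"
    and Lipschitz: "\<And>u v. \<lbrakk>u \<in> M; v \<in> M\<rbrakk> \<Longrightarrow> h u \<le> d u v + h v"
    and pos: "\<And>u. \<lbrakk>u \<in> M; u \<noteq> p\<rbrakk> \<Longrightarrow> 0 < h u"
  shows "Metric_space M (detour_metric d h)"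
proof
  fix u v
  show "0 \<le> detour_metric d h u v"
    using nonneg_h[of u] nonneg_h[of v] by (simp add: detour_metric_def)
  show "detour_metric d h u v = detour_metric d h v u"
    by (simp add: detour_metric_def commute add.commute)
next
  fix u v assume uv: "u \<in> M" "v \<in> M"
  show "detour_metric d h u v = 0 \<longleftrightarrow> u = v"
  proof
    assume "u = v"
    then show "detour_metric d h u v = 0"
      using uv nonneg_h[of v] by (simp add: detour_metric_def)
  next
    assume zero: "detour_metric d h u v = 0"
    show "u = v"
    proof (rule ccontr)
      assume "u \<noteq> v"
      then have "0 < h u + h v"
        using uv pos nonneg_h by (metis add_nonneg_pos add_pos_nonneg)
      moreover have "0 < d u v"
        using \<open>u \<noteq> v\<close> uv by simp
      ultimately show False
        using zero by (simp add: detour_metric_def min_def split: if_splits)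
    qed
  qed
next
  fix u v w assume uvw: "u \<in> M" "v \<in> M" "w \<in> M"
  \<comment> \<open>Each of the two legs via \<open>v\<close> is direct or a detour; only if both are direct is the
    comparison with the direct way from \<open>u\<close> to \<open>w\<close>.\<close>
  have "d u w \<le> d u v + d v w"
    by (rule triangle[OF uvw])
  moreover have "h u + h w \<le> d u v + (h v + h w)"
    using Lipschitz[OF uvw(1,2)] by simp
  moreover have "h u + h w \<le> (h u + h v) + d v w"
    using Lipschitz[OF uvw(3,2)] by (simp add: commute)
  moreover have "h u + h w \<le> (h u + h v) + (h v + h w)"
    using nonneg_h[of v] by simp
  ultimately show "detour_metric d h u w \<le> detour_metric d h u v + detour_metric d h v w"
    unfolding detour_metric_def min_add_distrib_left min_add_distrib_right
    by (intro min.boundedI) (blast intro: min.coboundedI1 min.coboundedI2)+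
qed

lemma openin_detour_metric_imp_openin:
  assumes "Metric_space M (detour_metric d h)"
    and "openin (Metric_space.mtopology M (detour_metric d h)) U"
  shows "openin mtopology U"
proof -
  interpret detour: Metric_space M "detour_metric d h" by fact
  have ball: "mball u r \<subseteq> detour.mball u r" for u r
    by (auto simp: detour_metric_def)
  have U: "U \<subseteq> M" "\<And>u. u \<in> U \<Longrightarrow> \<exists>r>0. detour.mball u r \<subseteq> U"
    using assms(2) by (simp_all add: detour.openin_mtopology)
  have "\<exists>r>0. mball u r \<subseteq> U" if "u \<in> U" for u
    using U(2)[OF that] subset_trans[OF ball] by meson
  with U(1) show ?thesis
    by (simp add: openin_mtopology)
qed

text \<open>Away from \<open>p\<close> the converse holds: within distance \<open>h u\<close> of \<open>u\<close> the detour is never the shorter way.\<close>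

lemma openin_imp_openin_detour_metric:
  assumes "Metric_space M (detour_metric d h)"
    and nonneg_h: "\<And>u. 0 \<le> h u"
    and pos: "\<And>u. \<lbrakk>u \<in> M; u \<noteq> p\<rbrakk> \<Longrightarrow> 0 < h u"
    and "openin mtopology U" and "p \<notin> U"
  shows "openin (Metric_space.mtopology M (detour_metric d h)) U"
proof -
  interpret detour: Metric_space M "detour_metric d h" by fact
  have "U \<subseteq> M"
    using assms(4) by (simp add: openin_mtopology)
  moreover have "\<exists>r>0. detour.mball u r \<subseteq> U" if "u \<in> U" for u
  proof -
    obtain r where r: "0 < r" "mball u r \<subseteq> U"
      using assms(4) \<open>u \<in> U\<close> by (auto simp: openin_mtopology)
    have "0 < h u"
      using pos \<open>U \<subseteq> M\<close> \<open>p \<notin> U\<close> \<open>u \<in> U\<close> by blast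
    moreover have "detour.mball u (min r (h u)) \<subseteq> mball u r"
    proof
      fix v assume "v \<in> detour.mball u (min r (h u))"
      then show "v \<in> mball u r"
        using nonneg_h[of v] by (auto simp: detour_metric_def min_less_iff_disj)
    qed
    ultimately show ?thesis
      using r by (intro exI[of _ "min r (h u)"]) auto
  qed
  ultimately show ?thesis
    by (simp add: detour.openin_mtopology)
qed

lemma subtopology_detour_metric:
  assumes "Metric_space M (detour_metric d h)"
    and "\<And>u. 0 \<le> h u"
    and "\<And>u. \<lbrakk>u \<in> M; u \<noteq> p\<rbrakk> \<Longrightarrow> 0 < h u"
  shows "subtopology (Metric_space.mtopology M (detour_metric d h)) (M - {p})
       = subtopology mtopology (M - {p})"
proof -
  interpret detour: Metric_space M "detour_metric d h" by fact
  have same: "openin detour.mtopology U \<longleftrightarrow> openin mtopology U" if "p \<notin> U" for U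
  proof
    show "openin detour.mtopology U" if "openin mtopology U"
      by (rule openin_imp_openin_detour_metric[OF assms(1,2) _ that \<open>p \<notin> U\<close>]) (rule assms(3))
  qed (rule openin_detour_metric_imp_openin[OF assms(1)])
  have "openin mtopology (topspace mtopology - {p})"
  proof (rule t1_space_openin_delete_alt[THEN iffD1, rule_format])
    show "t1_space mtopology"
      by (rule Hausdorff_imp_t1_space[OF Hausdorff_space_mtopology])
  qed (rule openin_topspace)
  then have open_compl: "openin mtopology (M - {p})"
    by simp
  then have open_compl_detour: "openin detour.mtopology (M - {p})"
    using same by simp
  show ?thesis
    unfolding topology_eq
      openin_open_subtopology[OF open_compl] openin_open_subtopology[OF open_compl_detour]
    using same by blast
qed

lemma limitin_detour_metric:
  assumes "Metric_space M (detour_metric d h)"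
    and "p \<in> M" and "h p = 0" and "range x \<subseteq> M" and "(\<lambda>n. h (x n)) \<longlonglongrightarrow> 0"
  shows "limitin (Metric_space.mtopology M (detour_metric d h)) x p sequentially"
proof -
  interpret detour: Metric_space M "detour_metric d h" by fact
  have "\<forall>\<^sub>F n in sequentially. x n \<in> M \<and> detour_metric d h (x n) p < \<epsilon>" if "0 < \<epsilon>" for \<epsilon>
    using order_tendstoD(2)[OF assms(5) that]
  proof eventually_elim
    case (elim n)
    then show ?case
      using assms(3,4) by (auto simp: detour_metric_def)
  qed
  then show ?thesis
    using \<open>p \<in> M\<close> by (simp add: detour.limitin_metric)
qed

section \<open>The height with tunnels along a closed discrete sequence\<close>

definition tunnel_height :: "(nat \<Rightarrow> 'a) \<Rightarrow> 'a \<Rightarrow> 'a \<Rightarrow> real" where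
  "tunnel_height x p u = min (d u p) (INF n. d u (x n) + 1 / real (Suc n))"

lemma tunnel_bdd_below: "bdd_below (range (\<lambda>n. d u (x n) + 1 / real (Suc n)))"
  by (rule bdd_belowI[of _ 0]) auto

lemma tunnel_height_nonneg: "0 \<le> tunnel_height x p u"
  unfolding tunnel_height_def by (auto intro!: cINF_greatest)

lemma tunnel_height_le: "tunnel_height x p u \<le> d u (x n) + 1 / real (Suc n)"
  unfolding tunnel_height_def
  by (intro min.coboundedI2 cINF_lower[OF tunnel_bdd_below]) simp

lemma tunnel_height_base: "p \<in> M \<Longrightarrow> tunnel_height x p p = 0"
  using tunnel_height_nonneg[of x p p] unfolding tunnel_height_def by simp

lemma tunnel_height_Lipschitz:
  assumes "p \<in> M" and "range x \<subseteq> M" and "u \<in> M" and "v \<in> M"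
  shows "tunnel_height x p u \<le> d u v + tunnel_height x p v"
proof -
  have "tunnel_height x p u - d u v \<le> d v p"
    using triangle[of u v p] assms unfolding tunnel_height_def by simp
  moreover have "tunnel_height x p u - d u v \<le> (INF n. d v (x n) + 1 / real (Suc n))"
  proof (rule cINF_greatest)
    fix n
    have "x n \<in> M"
      using assms(2) by blast
    then show "tunnel_height x p u - d u v \<le> d v (x n) + 1 / real (Suc n)"
      using triangle[of u v "x n"] tunnel_height_le[of x p u n] assms by simp
  qed simp
  ultimately show ?thesis
    unfolding tunnel_height_def[of x p v] by simp
qed

text \<open>If \<open>u\<close> is not an accumulation point of the injective sequence \<open>x\<close>, a small ball around \<open>u\<close>
  contains at most one \<open>x n\<close>, namely \<open>u\<close> itself. The tunnel from there has a positive length, and the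
  entrances of all other tunnels are outside the ball.\<close>

lemma tunnel_height_pos:
  assumes "inj x" and "range x \<subseteq> M" and "u \<notin> mtopology derived_set_of (range x)"
    and "p \<in> M" and "u \<in> M" and "u \<noteq> p"
  shows "0 < tunnel_height x p u"
proof -
  obtain T where T: "openin mtopology T" "u \<in> T" "\<And>y. \<lbrakk>y \<in> range x; y \<in> T\<rbrakk> \<Longrightarrow> y = u"
    using assms(3) \<open>u \<in> M\<close> unfolding derived_set_of_def by auto
  then obtain r where r: "0 < r" "mball u r \<subseteq> T"
    by (auto simp: openin_mtopology)
  \<comment> \<open>If \<open>u\<close> is not a term of \<open>x\<close>, then \<open>inv x u\<close> is an arbitrary index, which does no harm.\<close>
  define N where "N = inv x u"
  have "min r (1 / real (Suc N)) \<le> (INF n. d u (x n) + 1 / real (Suc n))"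
  proof (rule cINF_greatest)
    fix n
    show "min r (1 / real (Suc N)) \<le> d u (x n) + 1 / real (Suc n)"
    proof (cases "x n = u")
      case True
      then have "n = N"
        using \<open>inj x\<close> by (auto simp: N_def)
      then show ?thesis
        by (simp add: min.coboundedI2)
    next
      case False
      then have "x n \<notin> mball u r"
        using T(3) r(2) by blast
      moreover have "x n \<in> M"
        using assms(2) by blast
      ultimately have "r \<le> d u (x n)"
        using \<open>u \<in> M\<close> by auto
      moreover have "0 \<le> 1 / real (Suc n)"
        by simp
      ultimately show ?thesis
        by linarith
    qed
  qed simp
  moreover have "0 < min r (1 / real (Suc N))"
    using r(1) by simp
  moreover have "0 < d u p"
    using assms by simp
  ultimately show ?thesis
    unfolding tunnel_height_def by linarith
qed

lemma tunnel_height_tendsto: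
  assumes "range x \<subseteq> M"
  shows "(\<lambda>n. tunnel_height x p (x n)) \<longlonglongrightarrow> 0"
proof (rule tendsto_sandwich[OF _ _ tendsto_const LIMSEQ_Suc[OF lim_1_over_n]])
  show "\<forall>\<^sub>F n in sequentially. tunnel_height x p (x n) \<le> 1 / real (Suc n)"
  proof (rule always_eventually, rule allI)
    fix n
    have "x n \<in> M"
      using assms by blast
    then show "tunnel_height x p (x n) \<le> 1 / real (Suc n)"
      using tunnel_height_le[of x p "x n" n] by simp
  qed
qed (simp add: tunnel_height_nonneg)

end

section \<open>Coarsenings in which a closed discrete sequence converges\<close>

lemma ex_metrizable_coarsening_limitin:
  assumes "metrizable_space \<tau>"
    and x: "inj x" "range x \<subseteq> topspace \<tau>" "\<tau> derived_set_of (range x) = {}"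
    and p: "p \<in> topspace \<tau>" "p \<notin> range x"
  obtains \<sigma> where "metrizable_space \<sigma>" "strictly_coarser \<sigma> \<tau>"
    "subtopology \<sigma> (topspace \<tau> - {p}) = subtopology \<tau> (topspace \<tau> - {p})"
    "limitin \<sigma> x p sequentially"
proof -
  obtain M d where "Metric_space M d" and \<tau>: "\<tau> = Metric_space.mtopology M d"
    using assms(1) by (auto simp: metrizable_space_def)
  interpret Metric_space M d by fact
  have xp: "range x \<subseteq> M" "p \<in> M"
    using x(2) p(1) by (auto simp: \<tau>)
  define h where "h = tunnel_height x p"
  have nonneg_h: "0 \<le> h u" for u
    by (simp add: h_def tunnel_height_nonneg)
  have pos: "0 < h u" if "u \<in> M" "u \<noteq> p" for u
    unfolding h_def using tunnel_height_pos[OF x(1) xp(1) _ xp(2) that] x(3) by (simp add: \<tau>)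
  have detour: "Metric_space M (detour_metric d h)"
    by (rule Metric_space_detour_metric[OF nonneg_h _ pos])
      (simp add: h_def tunnel_height_Lipschitz xp)
  interpret detour: Metric_space M "detour_metric d h" by fact
  have coarser: "coarser detour.mtopology \<tau>"
    using openin_detour_metric_imp_openin[OF detour] by (simp add: coarser_def \<tau>)
  have lim: "limitin detour.mtopology x p sequentially"
    by (rule limitin_detour_metric[OF detour xp(2) _ xp(1)])
      (simp_all add: h_def tunnel_height_base tunnel_height_tendsto xp)
  \<comment> \<open>The range of \<open>x\<close> is closed in \<open>\<tau>\<close> and does not contain \<open>p\<close>, so \<open>x\<close> cannot converge to \<open>p\<close> there.\<close>
  have "\<not> limitin \<tau> x p sequentially"
    using limitin_closedin[of \<tau> x p sequentially "range x"] x p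
    by (auto simp: closedin_contains_derived_set)
  with lim coarser have "strictly_coarser detour.mtopology \<tau>"
    unfolding strictly_coarser_def by (intro conjI notI) simp_all
  moreover have "subtopology detour.mtopology (topspace \<tau> - {p}) = subtopology \<tau> (topspace \<tau> - {p})"
    unfolding \<tau> topspace_mtopology by (rule subtopology_detour_metric[OF detour nonneg_h pos])
  ultimately show thesis
    using that[OF detour.metrizable_space_mtopology] lim by blast
qed

lemma limitin_coarser:
  assumes "coarser \<rho> \<sigma>" and "limitin \<sigma> x p G"
  shows "limitin \<rho> x p G"
  using assms by (simp add: coarser_def limitin_def)

lemma ex_sequence_no_accumulation:
  assumes "metrizable_space \<tau>" and "\<not> compact_space \<tau>" and "finite F"
  obtains x :: "nat \<Rightarrow> 'a"
  where "inj x" "range x \<subseteq> topspace \<tau> - F" "\<tau> derived_set_of (range x) = {}"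
proof -
  obtain M d where "Metric_space M d" and \<tau>: "\<tau> = Metric_space.mtopology M d"
    using assms(1) by (auto simp: metrizable_space_def)
  interpret Metric_space M d by fact
  obtain S where S: "S \<subseteq> M" "infinite S" "\<tau> derived_set_of S = {}"
    using assms(2) by (auto simp: compact_space_eq_Bolzano_Weierstrass \<tau>)
  then have "infinite (S - F)"
    using \<open>finite F\<close> by simp
  then obtain x :: "nat \<Rightarrow> 'a" where x: "inj x" "range x \<subseteq> S - F"
    by (meson infinite_countable_subset)
  moreover have "\<tau> derived_set_of (range x) = {}"
    using derived_set_of_mono[of "range x" S \<tau>] x(2) S(3) by blast
  moreover have "range x \<subseteq> topspace \<tau> - F"
    using x(2) S(1) by (auto simp: \<tau>)
  ultimately show thesis
    using that by blast
qed

lemma metrizable_coarsenings_one_point: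
  assumes "metrizable_space \<sigma>" and "coarser \<sigma> \<tau>" and "p \<in> F"
    and "subtopology \<sigma> (topspace \<tau> - {p}) = subtopology \<tau> (topspace \<tau> - {p})"
  shows "\<sigma> \<in> metrizable_coarsenings F \<tau>"
proof -
  have "(topspace \<tau> - {p}) \<inter> (topspace \<tau> - F) = topspace \<tau> - F"
    using \<open>p \<in> F\<close> by blast
  then have "subtopology \<sigma> (topspace \<tau> - F) = subtopology \<tau> (topspace \<tau> - F)"
    using assms(4) by (metis subtopology_subtopology)
  then show ?thesis
    using assms(1,2) by (simp add: metrizable_coarsenings_def)
qed

theorem theorem6p4:
  fixes \<tau> :: "'a topology" and F :: "'a set" and a b :: 'a
  assumes "metrizable_space \<tau>" and "\<not> compact_space \<tau>"
    and "F \<subseteq> topspace \<tau>" and "finite F" and "card F \<ge> 2"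
    and "a \<in> F" and "b \<in> F" and "a \<noteq> b"
  shows "\<exists>\<sigma>\<^sub>a \<sigma>\<^sub>b D. \<exists>x :: nat \<Rightarrow> 'a.
     \<sigma>\<^sub>a \<in> metrizable_coarsenings F \<tau> \<and> strictly_coarser \<sigma>\<^sub>a \<tau> \<and>
     \<sigma>\<^sub>b \<in> metrizable_coarsenings F \<tau> \<and> strictly_coarser \<sigma>\<^sub>b \<tau> \<and>
     bij_betw x UNIV D \<and> D \<subseteq> topspace \<tau> - F \<and>
     closedin \<tau> D \<and> subtopology \<tau> D = discrete_topology D \<and>
     subtopology \<sigma>\<^sub>a (topspace \<tau> - {a}) = subtopology \<tau> (topspace \<tau> - {a}) \<and>
     subtopology \<sigma>\<^sub>b (topspace \<tau> - {b}) = subtopology \<tau> (topspace \<tau> - {b}) \<and>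
     limitin \<sigma>\<^sub>a x a sequentially \<and> limitin \<sigma>\<^sub>b x b sequentially \<and>
     (\<forall>\<rho>. coarser \<rho> \<sigma>\<^sub>a \<and> coarser \<rho> \<sigma>\<^sub>b \<longrightarrow> \<not> Hausdorff_space \<rho>)"
proof -
  obtain x :: "nat \<Rightarrow> 'a"
    where x: "inj x" "range x \<subseteq> topspace \<tau> - F" "\<tau> derived_set_of (range x) = {}"
    using ex_sequence_no_accumulation[OF assms(1,2,4)] by blast
  have x_in: "range x \<subseteq> topspace \<tau>" and ab: "a \<in> topspace \<tau>" "a \<notin> range x" "b \<in> topspace \<tau>" "b \<notin> range x"
    using x(2) assms(3,6,7) by blast+
  obtain \<sigma>\<^sub>a where \<sigma>\<^sub>a: "metrizable_space \<sigma>\<^sub>a" "strictly_coarser \<sigma>\<^sub>a \<tau>"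
    "subtopology \<sigma>\<^sub>a (topspace \<tau> - {a}) = subtopology \<tau> (topspace \<tau> - {a})"
    "limitin \<sigma>\<^sub>a x a sequentially"
    using ex_metrizable_coarsening_limitin[OF assms(1) x(1) x_in x(3) ab(1,2)] .
  obtain \<sigma>\<^sub>b where \<sigma>\<^sub>b: "metrizable_space \<sigma>\<^sub>b" "strictly_coarser \<sigma>\<^sub>b \<tau>"
    "subtopology \<sigma>\<^sub>b (topspace \<tau> - {b}) = subtopology \<tau> (topspace \<tau> - {b})"
    "limitin \<sigma>\<^sub>b x b sequentially"
    using ex_metrizable_coarsening_limitin[OF assms(1) x(1) x_in x(3) ab(3,4)] .
  have "\<sigma>\<^sub>a \<in> metrizable_coarsenings F \<tau>" "\<sigma>\<^sub>b \<in> metrizable_coarsenings F \<tau>"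
    using metrizable_coarsenings_one_point[OF \<sigma>\<^sub>a(1) _ assms(6) \<sigma>\<^sub>a(3)] \<sigma>\<^sub>a(2)
      metrizable_coarsenings_one_point[OF \<sigma>\<^sub>b(1) _ assms(7) \<sigma>\<^sub>b(3)] \<sigma>\<^sub>b(2)
    by (simp_all add: strictly_coarser_def)
  moreover have "bij_betw x UNIV (range x)"
    using x(1) by (simp add: bij_betw_def)
  moreover have "closedin \<tau> (range x)"
    using x_in x(3) by (simp add: closedin_contains_derived_set)
  moreover have "subtopology \<tau> (range x) = discrete_topology (range x)"
    using x_in x(3) by (simp add: subtopology_eq_discrete_topology_eq)
  moreover have "\<not> Hausdorff_space \<rho>" if "coarser \<rho> \<sigma>\<^sub>a" "coarser \<rho> \<sigma>\<^sub>b" for \<rho>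
    using limitin_Hausdorff_unique[OF limitin_coarser[OF that(1) \<sigma>\<^sub>a(4)]
        limitin_coarser[OF that(2) \<sigma>\<^sub>b(4)]] \<open>a \<noteq> b\<close> by auto
  ultimately show ?thesis
    using \<sigma>\<^sub>a(2-4) \<sigma>\<^sub>b(2-4) x(2)
    by - (rule exI[of _ \<sigma>\<^sub>a], rule exI[of _ \<sigma>\<^sub>b], rule exI[of _ "range x"], rule exI[of _ x], simp)
qed

end
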